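(* Let $A$ be a Banach algebra, $\phi\in\Delta(A)$, $B$ a subalgebra of $A$ and $J$ a closed left ideal of $A$. Regard $A$, $J$ and $A/J$ as Banach left $A$-modules in the natural way. Then: (i) If $B$ is left invariantly complemented in $A$ and $A$ is $\phi$-injective as a Banach left $A$-module, then $B$ is $\phi$-injective as a Banach left $A$-module. (ii) If $J$ is left invariantly complemented in $A$, then both $J$ and $A/J$ are $\phi$-injective as Banach left $A$-modules if and only if $A$ is $\phi$-injective as a Banach left $A$-module.
   Context: $\Delta(A)$ is the set of characters of the Banach algebra $A$, i.e. non-zero (algebra) homomorphisms $A\to\mathbb{C}$. For Banach left $A$-modules $F,K$, $_{A}B(F,K)$ is the space of bounded linear left $A$-module morphisms $F\to K$. A bounded linear operator $T:F\to K$ is admissible if $\ker T$ and $\operatorname{Im}T$ are closed complemented subspaces of $F$ and $K$ respectively (equivalently, there is a bounded linear $S:K\to F$ with $T\circ S\circ T=T$). A monomorphism is an injective bounded module morphism. For a Banach left $A$-module $K$ and $\phi\in\Delta(A)$, $I(\phi,K)=\operatorname{span}\{a\cdot x-\phi(a)x : a\in A,\ x\in K\}$. A Banach left $A$-module $E$ is $\phi$-injective if for all Banach left $A$-modules $F,K$ and every admissible monomorphism $T\in{}_{A}B(F,K)$ with $I(\phi,K)\subseteq\operatorname{Im}T$, the map $_{A}B(K,E)\to{}_{A}B(F,E)$, $R\mapsto R\circ T$, is onto. Let $X$ be a Banach left $A$-module and $Y$ a Banach $A$-submodule of $X$. $Y$ is left invariantly complemented in $X$ if there is $P\in{}_{A}B(X,Y)$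 with $P^{2}=P$ and $P(X)=Y$. (So saying that the subalgebra $B$ is left invariantly complemented in $A$ presupposes that $B$ is a Banach left $A$-submodule of $A$, where $A$ acts by left multiplication.) *)

theory Defs
  imports Complex_Main "HOL-Algebra.AbelCoset" "HOL-Algebra.Module"
begin

text \<open>
  The library has only real normed algebras, so complex scalars are added on top of
  \<open>real_normed_algebra\<close> and \<open>banach\<close>. No unit is required.
\<close>

class complex_banach_algebra = real_normed_algebra + banach +
  fixes scaleC :: "complex \<Rightarrow> 'a \<Rightarrow> 'a" (infixr \<open>*\<^sub>C\<close> 75)
  assumes scaleR_scaleC: "scaleR r x = complex_of_real r *\<^sub>C x"
    and scaleC_add_right: "c *\<^sub>C (x + y) = c *\<^sub>C x + c *\<^sub>C y"
    and scaleC_add_left: "(c + d) *\<^sub>C x = c *\<^sub>C x + d *\<^sub>C x"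
    and scaleC_scaleC: "c *\<^sub>C (d *\<^sub>C x) = (c * d) *\<^sub>C x"
    and scaleC_one: "1 *\<^sub>C x = x"
    and mult_scaleC_left: "(c *\<^sub>C x) * y = c *\<^sub>C (x * y)"
    and mult_scaleC_right: "x * (c *\<^sub>C y) = c *\<^sub>C (x * y)"
    and norm_scaleC: "norm (c *\<^sub>C x) = cmod c * norm x"

definition characters :: "('a::complex_banach_algebra \<Rightarrow> complex) set" where
  "characters = {\<phi>. (\<forall>a b. \<phi> (a + b) = \<phi> a + \<phi> b) \<and> (\<forall>c a. \<phi> (c *\<^sub>C a) = c * \<phi> a) \<and>
     (\<forall>a b. \<phi> (a * b) = \<phi> a * \<phi> b) \<and> (\<exists>a. \<phi> a \<noteq> 0)}"

definition linear_subspace :: "'a::complex_banach_algebra set \<Rightarrow> bool" where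
  "linear_subspace V \<longleftrightarrow> 0 \<in> V \<and> (\<forall>x\<in>V. \<forall>y\<in>V. x + y \<in> V) \<and> (\<forall>c. \<forall>x\<in>V. c *\<^sub>C x \<in> V)"

definition is_subalgebra :: "'a::complex_banach_algebra set \<Rightarrow> bool" where
  "is_subalgebra B \<longleftrightarrow> linear_subspace B \<and> (\<forall>x\<in>B. \<forall>y\<in>B. x * y \<in> B)"

definition left_ideal :: "'a::complex_banach_algebra set \<Rightarrow> bool" where
  "left_ideal J \<longleftrightarrow> linear_subspace J \<and> (\<forall>a. \<forall>x\<in>J. a * x \<in> J)"

text \<open>
  Banach modules over the algebra \<open>'a\<close> are structures with an explicit carrier in a type \<open>'x\<close>,
  so that submodules, quotients and quantification over all modules can be expressed. The record
  extends that of HOL-Algebra modules, over the field of complex numbers; its components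
  \<open>mult\<close> and \<open>one\<close> play no role.
\<close>

definition complex_field :: "complex ring" where
  "complex_field = \<lparr>carrier = UNIV, mult = (*), one = 1, zero = 0, add = (+)\<rparr>"

record ('a, 'x) normed_lmodule = "(complex, 'x) module" +
  nrm :: "'x \<Rightarrow> real"
  act :: "['a, 'x] \<Rightarrow> 'x" (infixr \<open>\<rhd>\<index>\<close> 75)

locale banach_left_module = Module.module complex_field M
  for M :: "('a::complex_banach_algebra, 'x, 'm) normed_lmodule_scheme" (structure) +
  assumes nrm_nonneg: "x \<in> carrier M \<Longrightarrow> 0 \<le> nrm M x"
    and nrm_eq_0: "x \<in> carrier M \<Longrightarrow> nrm M x = 0 \<longleftrightarrow> x = \<zero>"
    and nrm_add: "\<lbrakk>x \<in> carrier M; y \<in> carrier M\<rbrakk> \<Longrightarrow> nrm M (x \<oplus> y) \<le> nrm M x + nrm M y"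
    and nrm_smult: "x \<in> carrier M \<Longrightarrow> nrm M (c \<odot> x) = cmod c * nrm M x"
    and nrm_complete:
      "\<lbrakk>range s \<subseteq> carrier M;
        \<forall>e>0. \<exists>N::nat. \<forall>m\<ge>N. \<forall>n\<ge>N. nrm M (s m \<ominus> s n) < e\<rbrakk>
       \<Longrightarrow> \<exists>x\<in>carrier M. (\<lambda>n. nrm M (s n \<ominus> x)) \<longlonglongrightarrow> 0"
    and act_closed: "x \<in> carrier M \<Longrightarrow> a \<rhd> x \<in> carrier M"
    and act_add_right: "\<lbrakk>x \<in> carrier M; y \<in> carrier M\<rbrakk> \<Longrightarrow> a \<rhd> (x \<oplus> y) = a \<rhd> x \<oplus> a \<rhd> y"
    and act_add_left: "x \<in> carrier M \<Longrightarrow> (a + b) \<rhd> x = a \<rhd> x \<oplus> b \<rhd> x"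
    and act_smult_right: "x \<in> carrier M \<Longrightarrow> a \<rhd> (c \<odot> x) = c \<odot> (a \<rhd> x)"
    and act_smult_left: "x \<in> carrier M \<Longrightarrow> (c *\<^sub>C a) \<rhd> x = c \<odot> (a \<rhd> x)"
    and act_mult: "x \<in> carrier M \<Longrightarrow> (a * b) \<rhd> x = a \<rhd> (b \<rhd> x)"
    and act_bounded: "\<exists>C. \<forall>a. \<forall>x\<in>carrier M. nrm M (a \<rhd> x) \<le> C * norm a * nrm M x"

definition regular_module :: "('a::complex_banach_algebra, 'a) normed_lmodule" where
  "regular_module = \<lparr>carrier = UNIV, mult = (*), one = undefined, zero = 0, add = (+),
     smult = scaleC, nrm = norm, act = (*)\<rparr>"

text \<open>The norm of a coset is the quotient norm, its distance to zero.\<close>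

definition quotient_module ::
  "('a, 'x, 'm) normed_lmodule_scheme \<Rightarrow> 'x set \<Rightarrow> ('a, 'x set) normed_lmodule" where
  "quotient_module M Y = \<lparr>carrier = a_rcosets\<^bsub>M\<^esub> Y, mult = undefined, one = undefined,
     zero = Y, add = set_add M,
     smult = (\<lambda>c X. \<Union>x\<in>X. Y +>\<^bsub>M\<^esub> (c \<odot>\<^bsub>M\<^esub> x)),
     nrm = (\<lambda>X. INF x\<in>X. nrm M x),
     act = (\<lambda>a X. \<Union>x\<in>X. Y +>\<^bsub>M\<^esub> (a \<rhd>\<^bsub>M\<^esub> x))\<rparr>"

definition bounded_operators ::
  "('a, 'x, 'm) normed_lmodule_scheme \<Rightarrow> ('a, 'y, 'n) normed_lmodule_scheme \<Rightarrow> ('x \<Rightarrow> 'y) set" where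
  "bounded_operators F K = {T \<in> carrier F \<rightarrow> carrier K.
     (\<forall>x\<in>carrier F. \<forall>y\<in>carrier F. T (x \<oplus>\<^bsub>F\<^esub> y) = T x \<oplus>\<^bsub>K\<^esub> T y) \<and>
     (\<forall>c. \<forall>x\<in>carrier F. T (c \<odot>\<^bsub>F\<^esub> x) = c \<odot>\<^bsub>K\<^esub> T x) \<and>
     (\<exists>C. \<forall>x\<in>carrier F. nrm K (T x) \<le> C * nrm F x)}"

definition bounded_morphisms ::
  "('a, 'x, 'm) normed_lmodule_scheme \<Rightarrow> ('a, 'y, 'n) normed_lmodule_scheme \<Rightarrow> ('x \<Rightarrow> 'y) set" where
  "bounded_morphisms F K = {T \<in> bounded_operators F K.
     \<forall>a. \<forall>x\<in>carrier F. T (a \<rhd>\<^bsub>F\<^esub> x) = a \<rhd>\<^bsub>K\<^esub> T x}"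

definition closed_subspace :: "('a, 'x, 'm) normed_lmodule_scheme \<Rightarrow> 'x set \<Rightarrow> bool" where
  "closed_subspace M Y \<longleftrightarrow> submodule Y complex_field M \<and>
     (\<forall>s::nat \<Rightarrow> 'x. \<forall>x\<in>carrier M.
        range s \<subseteq> Y \<and> (\<lambda>n. nrm M (s n \<ominus>\<^bsub>M\<^esub> x)) \<longlonglongrightarrow> 0 \<longrightarrow> x \<in> Y)"

definition closed_complemented :: "('a, 'x, 'm) normed_lmodule_scheme \<Rightarrow> 'x set \<Rightarrow> bool" where
  "closed_complemented M Y \<longleftrightarrow> closed_subspace M Y \<and>
     (\<exists>Z. closed_subspace M Z \<and> Y <+>\<^bsub>M\<^esub> Z = carrier M \<and> Y \<inter> Z = {\<zero>\<^bsub>M\<^esub>})"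

definition admissible ::
  "('a, 'x, 'm) normed_lmodule_scheme \<Rightarrow> ('a, 'y, 'n) normed_lmodule_scheme \<Rightarrow> ('x \<Rightarrow> 'y) \<Rightarrow> bool" where
  "admissible F K T \<longleftrightarrow> T \<in> bounded_operators F K \<and>
     closed_complemented F (a_kernel F K T) \<and> closed_complemented K (T ` carrier F)"

text \<open>The linear span, not its closure.\<close>

definition I_span :: "('a \<Rightarrow> complex) \<Rightarrow> ('a, 'x, 'm) normed_lmodule_scheme \<Rightarrow> 'x set" where
  "I_span \<phi> K = (\<lambda>V. submodule V complex_field K) hull
     {a \<rhd>\<^bsub>K\<^esub> x \<ominus>\<^bsub>K\<^esub> \<phi> a \<odot>\<^bsub>K\<^esub> x | a x. x \<in> carrier K}"

text \<open>
  HOL cannot quantify over all types inside a formula. The test modules \<open>F\<close> and \<open>K\<close> therefore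
  range over all Banach left modules whose carrier lies in a type \<open>'u\<close>, which acts as a
  universe and is left arbitrary.
\<close>

definition phi_injective ::
  "'u itself \<Rightarrow> ('a::complex_banach_algebra \<Rightarrow> complex) \<Rightarrow> ('a, 'x, 'm) normed_lmodule_scheme \<Rightarrow> bool"
where
  "phi_injective _ \<phi> E \<longleftrightarrow> banach_left_module E \<and>
     (\<forall>(F :: ('a, 'u) normed_lmodule) (K :: ('a, 'u) normed_lmodule) T.
        banach_left_module F \<and> banach_left_module K \<and>
        T \<in> bounded_morphisms F K \<and> inj_on T (carrier F) \<and> admissible F K T \<and>
        I_span \<phi> K \<subseteq> T ` carrier F \<longrightarrow>
        (\<forall>S\<in>bounded_morphisms F E. \<exists>R\<in>bounded_morphisms K E. \<forall>x\<in>carrier F. R (T x) = S x))"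

text \<open>A Banach submodule carries the restricted norm, so its completeness makes it closed.\<close>

definition banach_submodule ::
  "('a::complex_banach_algebra, 'x, 'm) normed_lmodule_scheme \<Rightarrow> 'x set \<Rightarrow> bool" where
  "banach_submodule X Y \<longleftrightarrow> Y \<subseteq> carrier X \<and> banach_left_module (X\<lparr>carrier := Y\<rparr>)"

definition left_invariantly_complemented ::
  "('a::complex_banach_algebra, 'x, 'm) normed_lmodule_scheme \<Rightarrow> 'x set \<Rightarrow> bool" where
  "left_invariantly_complemented X Y \<longleftrightarrow> banach_submodule X Y \<and>
     (\<exists>P\<in>bounded_morphisms X (X\<lparr>carrier := Y\<rparr>).
        (\<forall>x\<in>carrier X. P (P x) = P x) \<and> P ` carrier X = Y)"

end

theory Submission
  imports Defs
begin

text \<open>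
  Injectivity passes to retracts, and to a module split by two injective ones. A bounded module
  projection \<open>P\<close> onto \<open>J\<close> makes \<open>J\<close> a retract of \<open>A\<close>. Since \<open>x - P x\<close> depends only on
  the coset of \<open>x\<close>, it induces a bounded morphism \<open>A/J \<rightarrow> A\<close> splitting the quotient map,
  so \<open>A/J\<close> is a retract as well; this splitting also yields the completeness of \<open>A/J\<close>.
\<close>

subsection \<open>Bounded module morphisms\<close>

lemma bounded_morphismsI:
  assumes "\<And>x. x \<in> carrier F \<Longrightarrow> T x \<in> carrier K"
    and "\<And>x y. \<lbrakk>x \<in> carrier F; y \<in> carrier F\<rbrakk> \<Longrightarrow> T (x \<oplus>\<^bsub>F\<^esub> y) = T x \<oplus>\<^bsub>K\<^esub> T y"
    and "\<And>c x. x \<in> carrier F \<Longrightarrow> T (c \<odot>\<^bsub>F\<^esub> x) = c \<odot>\<^bsub>K\<^esub> T x"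
    and "\<And>a x. x \<in> carrier F \<Longrightarrow> T (a \<rhd>\<^bsub>F\<^esub> x) = a \<rhd>\<^bsub>K\<^esub> T x"
    and "\<And>x. x \<in> carrier F \<Longrightarrow> nrm K (T x) \<le> C * nrm F x"
  shows "T \<in> bounded_morphisms F K"
  using assms unfolding bounded_morphisms_def bounded_operators_def by blast

lemma bounded_morphismsD:
  assumes "T \<in> bounded_morphisms F K"
  shows "x \<in> carrier F \<Longrightarrow> T x \<in> carrier K"
    and "\<lbrakk>x \<in> carrier F; y \<in> carrier F\<rbrakk> \<Longrightarrow> T (x \<oplus>\<^bsub>F\<^esub> y) = T x \<oplus>\<^bsub>K\<^esub> T y"
    and "x \<in> carrier F \<Longrightarrow> T (c \<odot>\<^bsub>F\<^esub> x) = c \<odot>\<^bsub>K\<^esub> T x"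
    and "x \<in> carrier F \<Longrightarrow> T (a \<rhd>\<^bsub>F\<^esub> x) = a \<rhd>\<^bsub>K\<^esub> T x"
  using assms unfolding bounded_morphisms_def bounded_operators_def by auto

text \<open>Since norms are nonnegative, any bounding constant may be replaced by its absolute
  value. A nonnegative constant is what allows bounds to be multiplied under composition and
  \<open>1 + C\<close> to serve as a divisor.\<close>

lemma bounded_morphisms_bound:
  assumes "T \<in> bounded_morphisms F K" and "\<And>x. x \<in> carrier F \<Longrightarrow> 0 \<le> nrm F x"
  obtains C where "0 \<le> C" and "\<And>x. x \<in> carrier F \<Longrightarrow> nrm K (T x) \<le> C * nrm F x"
proof -
  obtain C where C: "\<And>x. x \<in> carrier F \<Longrightarrow> nrm K (T x) \<le> C * nrm F x"
    using assms(1) unfolding bounded_morphisms_def bounded_operators_def by blast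
  have "nrm K (T x) \<le> \<bar>C\<bar> * nrm F x" if "x \<in> carrier F" for x
    using C[OF that] mult_right_mono[OF abs_ge_self assms(2)[OF that]] by (rule order_trans)
  then show thesis using that[of "\<bar>C\<bar>"] by simp
qed

lemma bounded_morphisms_comp:
  assumes "banach_left_module F" and "banach_left_module K"
    and T: "T \<in> bounded_morphisms F K" and S: "S \<in> bounded_morphisms K L"
  shows "(\<lambda>x. S (T x)) \<in> bounded_morphisms F L"
proof -
  obtain C where C: "0 \<le> C" "\<And>x. x \<in> carrier F \<Longrightarrow> nrm K (T x) \<le> C * nrm F x"
    using bounded_morphisms_bound[OF T banach_left_module.nrm_nonneg[OF assms(1)]] by metis
  obtain D where D: "0 \<le> D" "\<And>x. x \<in> carrier K \<Longrightarrow> nrm L (S x) \<le> D * nrm K x"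
    using bounded_morphisms_bound[OF S banach_left_module.nrm_nonneg[OF assms(2)]] by metis
  have "nrm L (S (T x)) \<le> D * C * nrm F x" if x: "x \<in> carrier F" for x
    using D(2)[OF bounded_morphismsD(1)[OF T x]] mult_left_mono[OF C(2)[OF x] D(1)]
    by (simp add: mult.assoc)
  then show ?thesis
    by (intro bounded_morphismsI) (simp_all add: bounded_morphismsD[OF T] bounded_morphismsD[OF S])
qed

lemma bounded_morphisms_add:
  assumes "banach_left_module L"
    and S: "S \<in> bounded_morphisms K L" and T: "T \<in> bounded_morphisms K L"
  shows "(\<lambda>x. S x \<oplus>\<^bsub>L\<^esub> T x) \<in> bounded_morphisms K L"
proof -
  interpret L: banach_left_module L by fact
  note [simp] = bounded_morphismsD[OF S] bounded_morphismsD[OF T]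
  obtain C where C: "\<And>x. x \<in> carrier K \<Longrightarrow> nrm L (S x) \<le> C * nrm K x"
    using S unfolding bounded_morphisms_def bounded_operators_def by blast
  obtain D where D: "\<And>x. x \<in> carrier K \<Longrightarrow> nrm L (T x) \<le> D * nrm K x"
    using T unfolding bounded_morphisms_def bounded_operators_def by blast
  show ?thesis
  proof (rule bounded_morphismsI)
    fix x assume x: "x \<in> carrier K"
    show "nrm L (S x \<oplus>\<^bsub>L\<^esub> T x) \<le> (C + D) * nrm K x"
      using L.nrm_add[of "S x" "T x"] C[OF x] D[OF x] x by (simp add: distrib_right)
  next
    fix x y assume "x \<in> carrier K" "y \<in> carrier K"
    then show "S (x \<oplus>\<^bsub>K\<^esub> y) \<oplus>\<^bsub>L\<^esub> T (x \<oplus>\<^bsub>K\<^esub> y) = S x \<oplus>\<^bsub>L\<^esub> T x \<oplus>\<^bsub>L\<^esub> (S y \<oplus>\<^bsub>L\<^esub> T y)"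
      by (simp add: L.a_ac)
  qed (simp_all add: L.smult_r_distr L.act_add_right complex_field_def)
qed

subsection \<open>Permanence properties of injectivity\<close>

lemma phi_injective_banach: "phi_injective TYPE('u) \<phi> E \<Longrightarrow> banach_left_module E"
  by (simp add: phi_injective_def)

text \<open>Elimination form of the definition. The conditions on \<open>F\<close>, \<open>K\<close>
  and \<open>T\<close> stay one conjunction, so that a proof of injectivity can hand them over
  unopened.\<close>

lemma phi_injective_extension:
  fixes F K :: "('a::complex_banach_algebra, 'u) normed_lmodule"
  assumes E: "phi_injective TYPE('u) \<phi> E"
    and T: "banach_left_module F \<and> banach_left_module K \<and>
        T \<in> bounded_morphisms F K \<and> inj_on T (carrier F) \<and> admissible F K T \<and>
        I_span \<phi> K \<subseteq> T ` carrier F"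
    and S: "S \<in> bounded_morphisms F E"
  obtains R where "R \<in> bounded_morphisms K E" and "\<And>x. x \<in> carrier F \<Longrightarrow> R (T x) = S x"
proof -
  note ext = E[unfolded phi_injective_def, THEN conjunct2, rule_format, OF T S]
  then show thesis by (rule bexE) (rule that, assumption, erule bspec)
qed

text \<open>Push \<open>S\<close> into \<open>E\<close> along \<open>i\<close>, extend it there, and
  return along \<open>r\<close>; as \<open>r\<close> undoes \<open>i\<close>, the result extends
  \<open>S\<close>. The conditions on \<open>T\<close> do not involve the target module, so they
  carry over unchanged.\<close>

lemma phi_injective_retract:
  assumes E: "phi_injective TYPE('u) \<phi> E" and E': "banach_left_module E'"
    and i: "i \<in> bounded_morphisms E' E" and r: "r \<in> bounded_morphisms E E'"
    and ri: "\<And>x. x \<in> carrier E' \<Longrightarrow> r (i x) = x"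
  shows "phi_injective TYPE('u) \<phi> E'"
  unfolding phi_injective_def
proof (intro conjI allI impI ballI, fact E')
  fix F K :: "('a, 'u) normed_lmodule" and T S
  assume H: "banach_left_module F \<and> banach_left_module K \<and>
        T \<in> bounded_morphisms F K \<and> inj_on T (carrier F) \<and> admissible F K T \<and>
        I_span \<phi> K \<subseteq> T ` carrier F" and S: "S \<in> bounded_morphisms F E'"
  from H have F: "banach_left_module F" and K: "banach_left_module K" by blast+
  have "(\<lambda>x. i (S x)) \<in> bounded_morphisms F E"
    by (rule bounded_morphisms_comp[OF F E' S i])
  then obtain R where R: "R \<in> bounded_morphisms K E" "\<And>x. x \<in> carrier F \<Longrightarrow> R (T x) = i (S x)"
    using phi_injective_extension[OF E H] by metis
  have "(\<lambda>x. r (R x)) \<in> bounded_morphisms K E'"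
    by (rule bounded_morphisms_comp[OF K phi_injective_banach[OF E] R(1) r])
  moreover have "\<forall>x\<in>carrier F. r (R (T x)) = S x"
    using R(2) ri bounded_morphismsD(1)[OF S] by simp
  ultimately show "\<exists>R\<in>bounded_morphisms K E'. \<forall>x\<in>carrier F. R (T x) = S x"
    by (intro bexI[of _ "\<lambda>x. r (R x)"])
qed

text \<open>Extend the two components \<open>p1 (S x)\<close> and \<open>p2 (S x)\<close>
  separately, then recombine the extensions through \<open>i1\<close> and \<open>i2\<close>; on the
  image of \<open>T\<close> the splitting identity gives back \<open>S\<close>.\<close>

lemma phi_injective_split:
  assumes E1: "phi_injective TYPE('u) \<phi> E1" and E2: "phi_injective TYPE('u) \<phi> E2"
    and E: "banach_left_module E"
    and p1: "p1 \<in> bounded_morphisms E E1" and p2: "p2 \<in> bounded_morphisms E E2"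
    and i1: "i1 \<in> bounded_morphisms E1 E" and i2: "i2 \<in> bounded_morphisms E2 E"
    and split: "\<And>x. x \<in> carrier E \<Longrightarrow> i1 (p1 x) \<oplus>\<^bsub>E\<^esub> i2 (p2 x) = x"
  shows "phi_injective TYPE('u) \<phi> E"
  unfolding phi_injective_def
proof (intro conjI allI impI ballI, fact E)
  fix F K :: "('a, 'u) normed_lmodule" and T S
  assume H: "banach_left_module F \<and> banach_left_module K \<and>
        T \<in> bounded_morphisms F K \<and> inj_on T (carrier F) \<and> admissible F K T \<and>
        I_span \<phi> K \<subseteq> T ` carrier F" and S: "S \<in> bounded_morphisms F E"
  from H have F: "banach_left_module F" and K: "banach_left_module K" by blast+
  have "(\<lambda>x. p1 (S x)) \<in> bounded_morphisms F E1" "(\<lambda>x. p2 (S x)) \<in> bounded_morphisms F E2"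
    by (rule bounded_morphisms_comp[OF F E S p1], rule bounded_morphisms_comp[OF F E S p2])
  then obtain R1 R2 where
    R1: "R1 \<in> bounded_morphisms K E1" "\<And>x. x \<in> carrier F \<Longrightarrow> R1 (T x) = p1 (S x)" and
    R2: "R2 \<in> bounded_morphisms K E2" "\<And>x. x \<in> carrier F \<Longrightarrow> R2 (T x) = p2 (S x)"
    using phi_injective_extension[OF E1 H] phi_injective_extension[OF E2 H] by metis
  have "(\<lambda>x. i1 (R1 x)) \<in> bounded_morphisms K E" "(\<lambda>x. i2 (R2 x)) \<in> bounded_morphisms K E"
    by (rule bounded_morphisms_comp[OF K phi_injective_banach[OF E1] R1(1) i1],
        rule bounded_morphisms_comp[OF K phi_injective_banach[OF E2] R2(1) i2])
  then have "(\<lambda>x. i1 (R1 x) \<oplus>\<^bsub>E\<^esub> i2 (R2 x)) \<in> bounded_morphisms K E"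
    by (rule bounded_morphisms_add[OF E])
  moreover have "\<forall>x\<in>carrier F. i1 (R1 (T x)) \<oplus>\<^bsub>E\<^esub> i2 (R2 (T x)) = S x"
    using R1(2) R2(2) split bounded_morphismsD(1)[OF S] by simp
  ultimately show "\<exists>R\<in>bounded_morphisms K E. \<forall>x\<in>carrier F. R (T x) = S x"
    by (intro bexI[of _ "\<lambda>x. i1 (R1 x) \<oplus>\<^bsub>E\<^esub> i2 (R2 x)"])
qed

subsection \<open>The regular module\<close>

lemma cring_complex_field: "cring complex_field"
proof (rule cringI)
  show "abelian_group complex_field"
    by (rule abelian_groupI)
      (auto simp: complex_field_def add.assoc add.commute intro: exI[of _ "- _"] add.left_inverse)
  show "comm_monoid complex_field"
    by (rule comm_monoidI) (auto simp: complex_field_def)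
qed (auto simp: complex_field_def distrib_right)

lemma regular_module_simps [simp]:
  "carrier regular_module = UNIV" "zero regular_module = 0" "add regular_module = (+)"
  "smult regular_module = scaleC" "nrm regular_module = norm" "act regular_module = (*)"
  by (simp_all add: regular_module_def)

lemma abelian_group_regular: "abelian_group (regular_module :: ('a::complex_banach_algebra, 'a) normed_lmodule)"
proof (rule abelian_groupI)
  fix x :: 'a
  show "\<exists>y\<in>carrier regular_module. y \<oplus>\<^bsub>regular_module\<^esub> x = \<zero>\<^bsub>regular_module\<^esub>"
    by (auto intro: exI[of _ "- x"])
qed (simp_all add: add.assoc add.commute)

text \<open>Subtraction in the structure goes through its own additive inverse; uniqueness of
  inverses identifies it with that of the type. Cauchy and convergence conditions then become the
  usual ones.\<close>

lemma regular_module_minus [simp]: "x \<ominus>\<^bsub>regular_module\<^esub> y = (x::'a::complex_banach_algebra) - y"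
proof -
  interpret abelian_group "regular_module :: ('a, 'a) normed_lmodule" by (rule abelian_group_regular)
  have "\<ominus>\<^bsub>regular_module\<^esub> y = - y"
    by (rule minus_equality) simp_all
  then show ?thesis by (simp add: a_minus_def)
qed

lemma banach_left_module_regular:
  "banach_left_module (regular_module :: ('a::complex_banach_algebra, 'a) normed_lmodule)"
proof (intro banach_left_module.intro module.intro abelian_group_regular cring_complex_field
    module_axioms.intro banach_left_module_axioms.intro)
  fix s :: "nat \<Rightarrow> 'a"
  assume "\<forall>e>0. \<exists>N. \<forall>m\<ge>N. \<forall>n\<ge>N. nrm regular_module (s m \<ominus>\<^bsub>regular_module\<^esub> s n) < e"
  then have "Cauchy s" by (simp add: Cauchy_def dist_norm)
  then obtain x where "s \<longlonglongrightarrow> x" using Cauchy_convergent convergent_def by blast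
  then have "(\<lambda>n. norm (s n - x)) \<longlonglongrightarrow> 0" by (simp add: LIM_zero_iff tendsto_norm_zero)
  then show "\<exists>x\<in>carrier regular_module.
      (\<lambda>n. nrm regular_module (s n \<ominus>\<^bsub>regular_module\<^esub> x)) \<longlonglongrightarrow> 0"
    by auto
next
  show "\<exists>C. \<forall>a. \<forall>x\<in>carrier regular_module.
      nrm regular_module (a \<rhd>\<^bsub>regular_module\<^esub> (x::'a)) \<le> C * norm a * nrm regular_module x"
    by (auto intro: exI[of _ 1] simp: norm_mult_ineq)
qed (simp_all add: complex_field_def scaleC_add_right scaleC_add_left scaleC_scaleC scaleC_one
    mult_scaleC_left mult_scaleC_right norm_scaleC norm_triangle_ineq distrib_left distrib_right
    mult.assoc)

subsection \<open>Quotients by complemented left ideals\<close>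

locale module_projection =
  fixes J :: "'a::complex_banach_algebra set" and P :: "'a \<Rightarrow> 'a"
  assumes ideal: "left_ideal J"
    and morphism: "P \<in> bounded_morphisms regular_module (regular_module\<lparr>carrier := J\<rparr>)"
    and idem: "\<And>x. P (P x) = P x" and range_P: "range P = J"
begin

abbreviation quot :: "('a, 'a set) normed_lmodule" where
  "quot \<equiv> quotient_module regular_module J"

definition proj :: "'a \<Rightarrow> 'a set" where
  "proj x = (\<lambda>j. j + x) ` J"

text \<open>The choice of representative is immaterial because \<open>x - P x\<close> is constant on cosets.\<close>

definition sect :: "'a set \<Rightarrow> 'a" where
  "sect X = (SOME x. x \<in> X) - P (SOME x. x \<in> X)"

section \<open>Arithmetic of the ideal and its projection\<close>

lemma J_closed:
  shows "0 \<in> J" "\<lbrakk>x \<in> J; y \<in> J\<rbrakk> \<Longrightarrow> x + y \<in> J" "x \<in> J \<Longrightarrow> c *\<^sub>C x \<in> J"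
    "x \<in> J \<Longrightarrow> a * x \<in> J"
  using ideal unfolding left_ideal_def linear_subspace_def by auto

lemma J_uminus: "x \<in> J \<Longrightarrow> - x \<in> J"
  \<comment> \<open>Negation is scaling by -1, and \<open>scaleR_scaleC\<close> trades the complex
    scalar for the real one, where simplification knows the result.\<close>
  using J_closed(3)[of x "-1"] scaleR_scaleC[of "-1" x] by simp

lemma J_diff: "\<lbrakk>x \<in> J; y \<in> J\<rbrakk> \<Longrightarrow> x - y \<in> J"
  using J_closed(2)[of x "- y"] J_uminus[of y] by simp

lemma P_simps:
  "P (x + y) = P x + P y" "P (c *\<^sub>C x) = c *\<^sub>C P x" "P (a * x) = a * P x"
  using bounded_morphismsD[OF morphism] by simp_all

lemma P_uminus: "P (- x) = - P x"
  using P_simps(2)[of "-1" x] scaleR_scaleC[of "-1" x] scaleR_scaleC[of "-1" "P x"] by simp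

lemma P_diff: "P (x - y) = P x - P y"
  using P_simps(1)[of x "- y"] P_uminus[of y] by simp

lemma P_mem: "P x \<in> J"
  using range_P by blast

lemma P_fix: "x \<in> J \<Longrightarrow> P x = x"
  using range_P idem by (metis imageE)

section \<open>Cosets and the algebraic operations on them\<close>

lemma mem_proj_iff: "y \<in> proj x \<longleftrightarrow> y - x \<in> J"
  unfolding proj_def by (force intro: image_eqI[of _ _ "y - x"])

lemma self_mem_proj: "x \<in> proj x"
  by (simp add: mem_proj_iff J_closed)

lemma proj_eq_iff: "proj x = proj y \<longleftrightarrow> x - y \<in> J"
proof
  assume "proj x = proj y"
  then show "x - y \<in> J" using self_mem_proj[of x] by (simp add: mem_proj_iff)
next
  assume "x - y \<in> J"
  then have "z - x \<in> J \<longleftrightarrow> z - y \<in> J" for z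
    using J_closed(2)[of "z - x" "x - y"] J_diff[of "z - y" "x - y"] by auto
  then show "proj x = proj y" by (auto simp: mem_proj_iff)
qed

lemma proj_eqI: "y \<in> proj x \<Longrightarrow> proj y = proj x"
  by (simp add: proj_eq_iff mem_proj_iff)

lemma a_r_coset_eq_proj: "J +>\<^bsub>regular_module\<^esub> x = proj x"
  by (auto simp: a_r_coset_def' proj_def)

lemma carrier_quot: "carrier quot = range proj"
  by (auto simp: quotient_module_def A_RCOSETS_def' a_r_coset_eq_proj)

lemma zero_quot: "\<zero>\<^bsub>quot\<^esub> = proj 0"
  by (simp add: quotient_module_def proj_def)

lemma add_quot: "proj x \<oplus>\<^bsub>quot\<^esub> proj y = proj (x + y)"
proof -
  have "set_add regular_module (proj x) (proj y) = proj (x + y)"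
  proof (intro equalityI subsetI)
    fix z assume "z \<in> set_add regular_module (proj x) (proj y)"
    then obtain u v where "u - x \<in> J" "v - y \<in> J" "z = u + v"
      by (auto simp: set_add_def' mem_proj_iff)
    then show "z \<in> proj (x + y)"
      using J_closed(2)[of "u - x" "v - y"] by (simp add: mem_proj_iff algebra_simps)
  next
    fix z assume "z \<in> proj (x + y)"
    then have "z - y \<in> proj x" by (simp add: mem_proj_iff algebra_simps)
    \<comment> \<open>The whole offset in \<open>J\<close> goes to the first summand; the second
      coset is represented by \<open>y\<close> itself.\<close>
    moreover have "z = (z - y) + y" by simp
    ultimately show "z \<in> set_add regular_module (proj x) (proj y)"
      using self_mem_proj[of y] unfolding set_add_def' regular_module_simps by blast
  qed
  then show ?thesis by (simp add: quotient_module_def)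
qed

text \<open>The operation is defined as a union over all representatives. Each of them yields the
  same coset, since \<open>J\<close> absorbs scalars, so the union collapses.\<close>

lemma smult_quot: "c \<odot>\<^bsub>quot\<^esub> proj x = proj (c *\<^sub>C x)"
proof -
  have eq: "proj (c *\<^sub>C y) = proj (c *\<^sub>C x)" if "y \<in> proj x" for y
  proof -
    have "c *\<^sub>C (y - x) \<in> J" using that by (simp add: mem_proj_iff J_closed)
    moreover have "c *\<^sub>C y = c *\<^sub>C (y - x) + c *\<^sub>C x"
      by (simp add: scaleC_add_right[symmetric])
    ultimately show ?thesis by (simp add: proj_eq_iff)
  qed
  have "(\<Union>y\<in>proj x. proj (c *\<^sub>C y)) = proj (c *\<^sub>C x)"
    by (rule SUP_eq_const, use self_mem_proj in blast, rule eq)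
  then show ?thesis by (simp add: quotient_module_def a_r_coset_eq_proj)
qed

text \<open>The union collapses as for scalars, this time because \<open>J\<close> is stable under
  left multiplication.\<close>

lemma act_quot: "a \<rhd>\<^bsub>quot\<^esub> proj x = proj (a * x)"
proof -
  have eq: "proj (a * y) = proj (a * x)" if "y \<in> proj x" for y
    using that J_closed(4)[of "y - x" a] by (simp add: mem_proj_iff proj_eq_iff right_diff_distrib)
  have "(\<Union>y\<in>proj x. proj (a * y)) = proj (a * x)"
    by (rule SUP_eq_const, use self_mem_proj in blast, rule eq)
  then show ?thesis by (simp add: quotient_module_def a_r_coset_eq_proj)
qed

section \<open>The quotient norm and the section\<close>

lemma nrm_quot: "nrm quot X = (INF x\<in>X. norm x)"
  by (simp add: quotient_module_def)

lemma bdd_below_norm: "bdd_below (norm ` (X :: 'a set))"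
  by (rule bdd_belowI[of _ 0]) auto

lemma nrm_quot_le: "nrm quot (proj x) \<le> norm x"
  unfolding nrm_quot by (rule cINF_lower[OF bdd_below_norm self_mem_proj])

lemma nrm_quot_geI:
  assumes "\<And>y. y \<in> proj x \<Longrightarrow> c \<le> norm y"
  shows "c \<le> nrm quot (proj x)"
  unfolding nrm_quot using self_mem_proj[of x] by (intro cINF_greatest) (auto intro: assms)

lemma nrm_quot_nonneg: "0 \<le> nrm quot (proj x)"
  by (rule nrm_quot_geI) simp

text \<open>The infimum need not be attained, so estimates work with representatives that are
  optimal up to \<open>e\<close>.\<close>

lemma nrm_quot_approx:
  assumes "e > 0"
  obtains y where "proj y = proj x" and "norm y < nrm quot (proj x) + e"
proof -
  have "\<exists>y\<in>proj x. norm y < nrm quot (proj x) + e"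
    using cINF_less_iff[OF _ bdd_below_norm, of "proj x"] self_mem_proj[of x] assms
    unfolding nrm_quot by (metis empty_iff less_add_same_cancel1)
  then show thesis using that proj_eqI by blast
qed

text \<open>The chosen representative \<open>y\<close> differs from \<open>x\<close> by an element
  of \<open>J\<close>, which \<open>P\<close> fixes; hence \<open>y - P y = x - P x\<close>.\<close>

lemma sect_proj: "sect (proj x) = x - P x"
proof -
  define y where "y = (SOME y. y \<in> proj x)"
  have "y - x \<in> J"
    unfolding y_def mem_proj_iff[symmetric] using self_mem_proj by (rule someI)
  then have "P y - P x = y - x" using P_fix[of "y - x"] by (simp add: P_diff)
  then show ?thesis unfolding sect_def y_def[symmetric] by (simp add: algebra_simps)
qed

lemma proj_sect: "proj (sect (proj x)) = proj x"
  by (simp add: sect_proj proj_eq_iff J_uminus P_mem)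

text \<open>Every representative \<open>y\<close> satisfies
  \<open>norm (y - P y) \<le> (1 + C) * norm y\<close>, and the left side is the same for all of
  them, so the bound passes to the infimum.\<close>

lemma sect_bound:
  obtains C where "0 \<le> C" and "\<And>x. norm (sect (proj x)) \<le> C * nrm quot (proj x)"
proof -
  obtain C where C: "0 \<le> C" "\<And>x. norm (P x) \<le> C * norm x"
    by (rule bounded_morphisms_bound[OF morphism]) simp_all
  have bd: "norm (sect (proj x)) \<le> (1 + C) * norm x" for x
    using norm_triangle_ineq4[of x "P x"] C(2)[of x] by (simp add: sect_proj distrib_right)
  \<comment> \<open>Dividing by the positive constant isolates a lower bound for the norm of each
    representative, the form required by \<open>nrm_quot_geI\<close>.\<close>
  have "norm (sect (proj x)) / (1 + C) \<le> nrm quot (proj x)" for x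
  proof (rule nrm_quot_geI)
    fix y assume "y \<in> proj x"
    then show "norm (sect (proj x)) / (1 + C) \<le> norm y"
      using bd[of y] C(1) proj_eqI[of y x] by (simp add: divide_le_eq mult.commute)
  qed
  then have "norm (sect (proj x)) \<le> (1 + C) * nrm quot (proj x)" for x
    using C(1) by (simp add: divide_le_eq mult.commute)
  then show thesis using that[of "1 + C"] C(1) by simp
qed

section \<open>The quotient as a Banach left module\<close>

lemma abelian_group_quot: "abelian_group quot"
proof (rule abelian_groupI)
  fix X assume "X \<in> carrier quot"
  then obtain x where "X = proj x" by (auto simp: carrier_quot)
  then show "\<exists>Y\<in>carrier quot. Y \<oplus>\<^bsub>quot\<^esub> X = \<zero>\<^bsub>quot\<^esub>"
    by (auto simp: carrier_quot zero_quot add_quot intro!: exI[of _ "- x"])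
qed (auto simp: carrier_quot zero_quot add_quot ac_simps)

lemma minus_quot: "proj x \<ominus>\<^bsub>quot\<^esub> proj y = proj (x - y)"
proof -
  interpret abelian_group quot by (rule abelian_group_quot)
  have "\<ominus>\<^bsub>quot\<^esub> proj y = proj (- y)"
    by (rule minus_equality) (auto simp: add_quot zero_quot carrier_quot)
  then show ?thesis by (simp add: a_minus_def add_quot)
qed

lemma proj_morphism: "proj \<in> bounded_morphisms regular_module quot"
  by (rule bounded_morphismsI[where C = 1])
    (auto simp: carrier_quot add_quot smult_quot act_quot nrm_quot_le)

lemma sect_morphism: "sect \<in> bounded_morphisms quot regular_module"
proof -
  obtain C where "\<And>x. norm (sect (proj x)) \<le> C * nrm quot (proj x)"
    using sect_bound by blast
  \<comment> \<open>Distributivity over a difference comes from additivity applied to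
    \<open>x = (x - P x) + P x\<close>.\<close>
  moreover have "c *\<^sub>C (x - P x) = c *\<^sub>C x - c *\<^sub>C P x" for c x
    using scaleC_add_right[of c "x - P x" "P x"] by (simp add: algebra_simps)
  ultimately show ?thesis
    by (intro bounded_morphismsI[where C = C])
      (auto simp: carrier_quot add_quot smult_quot act_quot sect_proj P_simps algebra_simps)
qed

text \<open>Representatives optimal up to \<open>e / 2\<close> in the two cosets add up to a
  representative of the sum.\<close>

lemma nrm_quot_add: "nrm quot (proj (x + y)) \<le> nrm quot (proj x) + nrm quot (proj y)"
proof (rule field_le_epsilon)
  fix e :: real assume "0 < e"
  then have "0 < e / 2" by simp
  obtain u where u: "proj u = proj x" "norm u < nrm quot (proj x) + e / 2"
    using nrm_quot_approx[OF \<open>0 < e / 2\<close>] by blast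
  obtain v where v: "proj v = proj y" "norm v < nrm quot (proj y) + e / 2"
    using nrm_quot_approx[OF \<open>0 < e / 2\<close>] by blast
  have "proj (x + y) = proj (u + v)" using u(1) v(1) by (metis add_quot)
  then show "nrm quot (proj (x + y)) \<le> nrm quot (proj x) + nrm quot (proj y) + e"
    using nrm_quot_le[of "u + v"] norm_triangle_ineq[of u v] u(2) v(2) by simp
qed

lemma nrm_quot_smult_le: "nrm quot (proj (c *\<^sub>C x)) \<le> cmod c * nrm quot (proj x)"
proof (rule field_le_epsilon)
  fix e :: real assume "0 < e"
  \<comment> \<open>Adding 1 keeps the divisor positive when \<open>c = 0\<close>, and
    \<open>cmod c * (e / (cmod c + 1))\<close> is still at most \<open>e\<close>.\<close>
  then have "0 < e / (cmod c + 1)" by (simp add: add_nonneg_pos)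
  then obtain u where u: "proj u = proj x" "norm u < nrm quot (proj x) + e / (cmod c + 1)"
    using nrm_quot_approx by blast
  have "nrm quot (proj (c *\<^sub>C x)) \<le> cmod c * norm u"
    using nrm_quot_le[of "c *\<^sub>C u"] u(1) by (metis smult_quot norm_scaleC)
  also have "\<dots> \<le> cmod c * (nrm quot (proj x) + e / (cmod c + 1))"
    using u(2) by (intro mult_left_mono) auto
  also have "\<dots> \<le> cmod c * nrm quot (proj x) + e"
  proof -
    have "cmod c * e \<le> e * (cmod c + 1)" using \<open>0 < e\<close> by (simp add: algebra_simps)
    then show ?thesis by (simp add: distrib_left divide_le_eq add_nonneg_pos)
  qed
  finally show "nrm quot (proj (c *\<^sub>C x)) \<le> cmod c * nrm quot (proj x) + e" .
qed

text \<open>For nonzero \<open>c\<close> the reverse inequality is \<open>nrm_quot_smult_le\<close>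
  for the scalar \<open>inverse c\<close> and the element \<open>c *\<^sub>C x\<close>.\<close>

lemma nrm_quot_smult: "nrm quot (proj (c *\<^sub>C x)) = cmod c * nrm quot (proj x)"
proof (cases "c = 0")
  case True
  then show ?thesis
    using nrm_quot_smult_le[of c x] nrm_quot_nonneg[of "c *\<^sub>C x"] by simp
next
  case False
  have "x = inverse c *\<^sub>C (c *\<^sub>C x)" using False by (simp add: scaleC_scaleC scaleC_one)
  then have "nrm quot (proj x) \<le> cmod (inverse c) * nrm quot (proj (c *\<^sub>C x))"
    using nrm_quot_smult_le[of "inverse c" "c *\<^sub>C x"] by simp
  then have "cmod c * nrm quot (proj x) \<le> nrm quot (proj (c *\<^sub>C x))"
    using False mult_left_mono[of _ _ "cmod c"] by (fastforce simp: norm_inverse mult.assoc[symmetric])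
  then show ?thesis using nrm_quot_smult_le[of c x] by simp
qed

text \<open>The argument of \<open>nrm_quot_smult_le\<close>, with submultiplicativity of the norm
  replacing homogeneity.\<close>

lemma nrm_quot_act: "nrm quot (proj (a * x)) \<le> norm a * nrm quot (proj x)"
proof (rule field_le_epsilon)
  fix e :: real assume "0 < e"
  then have "0 < e / (norm a + 1)" by (simp add: add_nonneg_pos)
  then obtain u where u: "proj u = proj x" "norm u < nrm quot (proj x) + e / (norm a + 1)"
    using nrm_quot_approx by blast
  have "nrm quot (proj (a * x)) \<le> norm a * norm u"
    using nrm_quot_le[of "a * u"] norm_mult_ineq[of a u] u(1) by (metis act_quot order_trans)
  also have "\<dots> \<le> norm a * (nrm quot (proj x) + e / (norm a + 1))"
    using u(2) by (intro mult_left_mono) auto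
  also have "\<dots> \<le> norm a * nrm quot (proj x) + e"
  proof -
    have "norm a * e \<le> e * (norm a + 1)" using \<open>0 < e\<close> by (simp add: algebra_simps)
    then show ?thesis by (simp add: distrib_left divide_le_eq add_nonneg_pos)
  qed
  finally show "nrm quot (proj (a * x)) \<le> norm a * nrm quot (proj x) + e" .
qed

text \<open>Definiteness rests on the bounded section: it sends a coset of norm 0 to 0, and
  projecting back gives the zero coset.\<close>

lemma nrm_quot_eq_0: "nrm quot (proj x) = 0 \<longleftrightarrow> proj x = proj 0"
proof
  assume 0: "nrm quot (proj x) = 0"
  obtain C where "norm (sect (proj x)) \<le> C * nrm quot (proj x)" using sect_bound by blast
  with 0 have "sect (proj x) = 0" by simp
  then show "proj x = proj 0" using proj_sect[of x] by simp
next
  assume "proj x = proj 0"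
  then show "nrm quot (proj x) = 0"
    using nrm_quot_le[of 0] nrm_quot_nonneg[of 0] by simp
qed

text \<open>The section lifts a Cauchy sequence of cosets to a Cauchy sequence in the algebra; its
  limit, projected back, is the limit of the cosets because \<open>proj\<close> does not increase
  norms.\<close>

lemma quot_complete:
  assumes "range s \<subseteq> carrier quot"
    and "\<forall>e>0. \<exists>N::nat. \<forall>m\<ge>N. \<forall>n\<ge>N. nrm quot (s m \<ominus>\<^bsub>quot\<^esub> s n) < e"
  shows "\<exists>X\<in>carrier quot. (\<lambda>n. nrm quot (s n \<ominus>\<^bsub>quot\<^esub> X)) \<longlonglongrightarrow> 0"
proof -
  have "\<forall>n. \<exists>x. s n = proj x" using assms(1) by (auto simp: carrier_quot)
  then obtain t where t: "\<And>n. s n = proj (t n)" by metis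
  define q where "q n = sect (proj (t n))" for n
  obtain C where C: "0 \<le> C" "\<And>x. norm (sect (proj x)) \<le> C * nrm quot (proj x)"
    using sect_bound by blast
  \<comment> \<open>The section is additive, so a difference of lifts is the lift of the coset of
    \<open>t m - t n\<close>.\<close>
  have diff: "norm (q m - q n) \<le> C * nrm quot (s m \<ominus>\<^bsub>quot\<^esub> s n)" for m n
    using C(2)[of "t m - t n"] by (simp add: q_def t minus_quot sect_proj P_diff algebra_simps)
  have "Cauchy q"
  proof (rule CauchyI)
    fix e :: real assume "0 < e"
    \<comment> \<open>The bound \<open>C\<close> may be 0, hence the divisor \<open>C + 1\<close>;
      it also makes the final inequality strict.\<close>
    then have "0 < e / (C + 1)" using C(1) by simp
    then obtain N where N: "\<forall>m\<ge>N. \<forall>n\<ge>N. nrm quot (s m \<ominus>\<^bsub>quot\<^esub> s n) < e / (C + 1)"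
      using assms(2) by blast
    have "norm (q m - q n) < e" if "m \<ge> N" "n \<ge> N" for m n
    proof -
      have "norm (q m - q n) \<le> C * (e / (C + 1))"
        using diff[of m n] N that C(1) by (meson less_imp_le mult_left_mono order_trans)
      also have "\<dots> < e" using \<open>0 < e\<close> C(1) by (simp add: divide_less_eq algebra_simps)
      finally show ?thesis .
    qed
    then show "\<exists>N. \<forall>m\<ge>N. \<forall>n\<ge>N. norm (q m - q n) < e" by blast
  qed
  then obtain z where "q \<longlonglongrightarrow> z" using Cauchy_convergent convergent_def by blast
  then have lim: "(\<lambda>n. norm (q n - z)) \<longlonglongrightarrow> 0" by (simp add: LIM_zero_iff tendsto_norm_zero)
  have "s n = proj (q n)" for n by (simp add: t q_def proj_sect)
  then have "nrm quot (s n \<ominus>\<^bsub>quot\<^esub> proj z) = nrm quot (proj (q n - z))" for n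
    by (simp add: minus_quot)
  then have "(\<lambda>n. nrm quot (s n \<ominus>\<^bsub>quot\<^esub> proj z)) \<longlonglongrightarrow> 0"
    using tendsto_sandwich[OF _ _ tendsto_const lim, of "\<lambda>n. nrm quot (proj (q n - z))"]
    by (simp add: nrm_quot_nonneg nrm_quot_le)
  then show ?thesis by (auto simp: carrier_quot)
qed

lemma banach_left_module_quot: "banach_left_module quot"
proof (intro banach_left_module.intro module.intro abelian_group_quot cring_complex_field
    module_axioms.intro banach_left_module_axioms.intro)
  show "\<exists>C. \<forall>a. \<forall>X\<in>carrier quot. nrm quot (a \<rhd>\<^bsub>quot\<^esub> X) \<le> C * norm a * nrm quot X"
    by (intro exI[of _ 1]) (auto simp: carrier_quot act_quot nrm_quot_act)
\<comment> \<open>Completeness is \<open>quot_complete\<close>; the remaining axioms reduce to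
  statements about representatives.\<close>
qed (erule quot_complete, assumption |
    force simp: carrier_quot add_quot zero_quot smult_quot act_quot complex_field_def
      nrm_quot_nonneg nrm_quot_eq_0 nrm_quot_add nrm_quot_smult
      scaleC_add_right scaleC_add_left scaleC_scaleC scaleC_one
      mult_scaleC_left mult_scaleC_right distrib_left distrib_right mult.assoc)+

end

section \<open>Invariantly complemented submodules and the equivalence\<close>

lemma inclusion_morphism: "(\<lambda>x. x) \<in> bounded_morphisms (M\<lparr>carrier := Y\<rparr>) M" if "Y \<subseteq> carrier M"
  using that by (intro bounded_morphismsI[where C = 1]) auto

text \<open>An idempotent with image \<open>Y\<close> fixes \<open>Y\<close> pointwise, so
  \<open>P\<close> is a retraction for the inclusion and \<open>phi_injective_retract\<close>
  applies.\<close>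

lemma phi_injective_invariantly_complemented:
  assumes "left_invariantly_complemented E Y" and "phi_injective TYPE('u) \<phi> E"
  shows "phi_injective TYPE('u) \<phi> (E\<lparr>carrier := Y\<rparr>)"
proof -
  obtain P where Y: "Y \<subseteq> carrier E" "banach_left_module (E\<lparr>carrier := Y\<rparr>)"
    and P: "P \<in> bounded_morphisms E (E\<lparr>carrier := Y\<rparr>)" "\<forall>x\<in>carrier E. P (P x) = P x"
      "P ` carrier E = Y"
    using assms(1) unfolding left_invariantly_complemented_def banach_submodule_def by blast
  have "P x = x" if "x \<in> carrier (E\<lparr>carrier := Y\<rparr>)" for x
    using that P(2,3) by auto
  then show ?thesis
    by (rule phi_injective_retract[OF assms(2) Y(2) inclusion_morphism[OF Y(1)] P(1)])
qed

theorem theorem2p10: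
  fixes \<phi> :: "'a::complex_banach_algebra \<Rightarrow> complex" and B J :: "'a set"
  assumes "\<phi> \<in> characters"
    and "is_subalgebra B"
    and "left_ideal J" and "closed J"
  shows "(left_invariantly_complemented regular_module B \<and>
            phi_injective TYPE('u) \<phi> (regular_module :: ('a, 'a) normed_lmodule) \<longrightarrow>
          phi_injective TYPE('u) \<phi> (regular_module\<lparr>carrier := B\<rparr>)) \<and>
         (left_invariantly_complemented regular_module J \<longrightarrow>
          (phi_injective TYPE('u) \<phi> (regular_module\<lparr>carrier := J\<rparr>) \<and>
             phi_injective TYPE('u) \<phi> (quotient_module regular_module J) \<longleftrightarrow>
           phi_injective TYPE('u) \<phi> (regular_module :: ('a, 'a) normed_lmodule)))"
proof (intro conjI impI)
  assume "left_invariantly_complemented regular_module B \<and>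
    phi_injective TYPE('u) \<phi> (regular_module :: ('a, 'a) normed_lmodule)"
  then show "phi_injective TYPE('u) \<phi> (regular_module\<lparr>carrier := B\<rparr>)"
    using phi_injective_invariantly_complemented by blast
next
  assume J: "left_invariantly_complemented regular_module J"
  then obtain P where "module_projection J P"
    using \<open>left_ideal J\<close> unfolding left_invariantly_complemented_def module_projection_def by auto
  then interpret module_projection J P .
  show "phi_injective TYPE('u) \<phi> (regular_module\<lparr>carrier := J\<rparr>) \<and>
      phi_injective TYPE('u) \<phi> (quotient_module regular_module J) \<longleftrightarrow>
    phi_injective TYPE('u) \<phi> (regular_module :: ('a, 'a) normed_lmodule)"
  proof (intro iffI conjI)
    assume "phi_injective TYPE('u) \<phi> (regular_module\<lparr>carrier := J\<rparr>) \<and>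
      phi_injective TYPE('u) \<phi> quot"
    \<comment> \<open>The splitting is \<open>x = P x + (x - P x)\<close>: the first part lies in
      \<open>J\<close>, the second is the section applied to the coset of \<open>x\<close>.\<close>
    moreover have "P x \<oplus>\<^bsub>regular_module\<^esub> sect (proj x) = x" for x
      by (simp add: sect_proj)
    ultimately show "phi_injective TYPE('u) \<phi> (regular_module :: ('a, 'a) normed_lmodule)"
      using phi_injective_split[OF _ _ banach_left_module_regular morphism proj_morphism
          inclusion_morphism sect_morphism] by auto
  next
    assume A: "phi_injective TYPE('u) \<phi> (regular_module :: ('a, 'a) normed_lmodule)"
    show "phi_injective TYPE('u) \<phi> (regular_module\<lparr>carrier := J\<rparr>)"
      by (rule phi_injective_invariantly_complemented[OF J A])
    show "phi_injective TYPE('u) \<phi> quot"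
      \<comment> \<open>The section embeds the quotient into the algebra, and \<open>proj\<close> is
        the retraction.\<close>
      by (rule phi_injective_retract[OF A banach_left_module_quot sect_morphism proj_morphism])
        (auto simp: carrier_quot proj_sect)
  qed
qed

end
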